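(* Let $r\geq 2$ and suppose $C:\mathbb{Z}_r^n\to\mathbb{Z}_r^N$ is a $(q,c,\varepsilon)$-smooth code. Then for every $i\in[n]$ there exists a collection $M_i$ of at least $\varepsilon N/(2cq)$ pairwise disjoint subsets of $[N]$, each of size at most $q$, such that for every $Q\in M_i$, \[ \sum_{k=1}^{r-1}\sum_{S\in\mathbb{Z}_r^{|Q|}}\Big|\mathbb{E}_{x\sim\mathbb{Z}_r^n}\big[\omega_r^{S\cdot C(x)_Q-kx_i}\big]\Big|\geq\frac{\varepsilon r}{2}, \] where $x$ is uniform in $\mathbb{Z}_r^n$, $C(x)_Q$ is the restriction of $C(x)$ to the coordinates in $Q$, and $S\cdot y=\sum_jS_jy_j$ in $\mathbb{Z}_r$.
   Context: $\omega_r=e^{2\pi i/r}$. $C:\mathbb{Z}_r^n\to\mathbb{Z}_r^N$ is a $(q,c,\varepsilon)$-smooth code if there is a randomized decoding algorithm $\mathcal{A}$ such that for every $x\in\mathbb{Z}_r^n$ and $i\in[n]$, $\mathcal{A}$ makes at most $q$ non-adaptive queries to $C(x)$ and outputs $\mathcal{A}^{C(x)}(i)\in\mathbb{Z}_r$ with $\Pr[\mathcal{A}^{C(x)}(i)=x_i]\geq 1/r+\varepsilon$, and for every $x$, $i$ and $j\in[N]$, on input $i$ the probability that $\mathcal{A}$ queries coordinate $j$ is at most $c/N$. *)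

theory Defs
  imports "HOL-Probability.Probability"
begin

text \<open>
  The ring of integers modulo \<open>r\<close> is represented by \<open>{0..<int r}\<close>, and \<open>[n]\<close> by \<open>{..<n}\<close>.
  A vector over it indexed by a finite set \<open>I\<close> of coordinates is an extensional function on \<open>I\<close>.
\<close>

definition Zvec :: "nat \<Rightarrow> nat set \<Rightarrow> (nat \<Rightarrow> int) set" where
  "Zvec r I = I \<rightarrow>\<^sub>E {0..<int r}"

definition root_of_1 :: "nat \<Rightarrow> complex" where
  "root_of_1 r = exp (2 * of_real pi * \<i> / of_nat r)"

definition dotmod :: "nat \<Rightarrow> nat set \<Rightarrow> (nat \<Rightarrow> int) \<Rightarrow> (nat \<Rightarrow> int) \<Rightarrow> int" where
  "dotmod r I S y = (\<Sum>j\<in>I. S j * y j) mod int r"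

text \<open>
  A randomized non-adaptive decoder is a distribution over deterministic ones, for each input
  index \<open>i\<close>. A deterministic one is a pair \<open>(Q, g)\<close>: the set \<open>Q\<close> of queried coordinates, fixed
  before anything is read, and the function \<open>g\<close> that computes the output from the answers.
  The two components may be correlated. A discrete distribution is no restriction, because
  there are only finitely many \<open>Q\<close> and finitely many behaviours of \<open>g\<close> on the possible answers.
\<close>

type_synonym decoder = "nat \<Rightarrow> (nat set \<times> ((nat \<Rightarrow> int) \<Rightarrow> int)) pmf"

definition decode :: "decoder \<Rightarrow> (nat \<Rightarrow> int) \<Rightarrow> nat \<Rightarrow> int pmf" where
  "decode A w i = map_pmf (\<lambda>(Q, g). g (restrict w Q)) (A i)"

text \<open>
  By non-adaptivity the queried set does not depend on the codeword, so the last condition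
  of smoothness needs no quantification over messages.
\<close>

definition smooth_code ::
  "nat \<Rightarrow> nat \<Rightarrow> nat \<Rightarrow> nat \<Rightarrow> real \<Rightarrow> real \<Rightarrow> ((nat \<Rightarrow> int) \<Rightarrow> (nat \<Rightarrow> int)) \<Rightarrow> bool" where
  "smooth_code r n N q c \<epsilon> C \<longleftrightarrow>
     C \<in> Zvec r {..<n} \<rightarrow> Zvec r {..<N} \<and>
     (\<exists>A :: decoder.
        (\<forall>i<n. \<forall>(Q, g) \<in> set_pmf (A i).
           Q \<subseteq> {..<N} \<and> card Q \<le> q \<and> (\<forall>y \<in> Zvec r Q. g y \<in> {0..<int r})) \<and>
        (\<forall>x \<in> Zvec r {..<n}. \<forall>i<n. pmf (decode A (C x) i) (x i) \<ge> 1 / real r + \<epsilon>) \<and>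
        (\<forall>i<n. \<forall>j<N. measure_pmf.prob (A i) {(Q, g). j \<in> Q} \<le> c / real N))"

end

theory Submission
  imports Defs
begin

text \<open>
  Expanding \<open>\<omega> ^ (k * g y)\<close> in characters of the answers \<open>y\<close> shows that the advantage of a
  deterministic decoder \<open>(Q, g)\<close> over guessing is at most \<open>1/r\<close> times the double sum attached to
  \<open>Q\<close>. The average advantage is at least \<open>\<epsilon>\<close>, so the queried set is \<^emph>\<open>good\<close> (its double sum is at
  least \<open>\<epsilon> r/2\<close>) with probability at least \<open>\<epsilon>/2\<close>. For a maximal family \<open>M\<close> of disjoint good sets,
  every good queried set meets \<open>\<Union>M\<close>, which by smoothness has probability at most
  \<open>(q * card M) * c/N\<close>.
\<close>

section \<open>Powers of the root of unity\<close>

lemma root_of_1_nonzero [simp]: "root_of_1 r \<noteq> 0"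
  by (simp add: root_of_1_def)

lemma root_of_1_powi: "root_of_1 r powi d = exp (2 * of_real pi * \<i> * of_int d / of_nat r)"
  by (simp add: root_of_1_def exp_power_int mult_ac)

lemma norm_root_of_1_powi [simp]: "norm (root_of_1 r powi d) = 1"
  by (simp add: root_of_1_powi)

lemma root_of_1_powi_add: "root_of_1 r powi (d + e) = root_of_1 r powi d * root_of_1 r powi e"
  by (simp add: power_int_add)

text \<open>The root is primitive. Both the reduction of exponents modulo \<open>r\<close> and the
  vanishing of nontrivial character sums rest on this.\<close>

lemma root_of_1_powi_eq_1_iff:
  assumes "r > 0"
  shows "root_of_1 r powi d = 1 \<longleftrightarrow> int r dvd d"
proof -
  have "root_of_1 r powi d = 1 \<longleftrightarrow> (\<exists>m::int. 2 * pi * of_int d / of_nat r = of_int (2 * m) * pi)"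
    unfolding root_of_1_powi exp_eq_1 by simp
  also have "\<dots> \<longleftrightarrow> (\<exists>m::int. (of_int d :: real) = of_int (int r * m))"
    using assms by (intro ex_cong1) (auto simp: field_simps)
  also have "\<dots> \<longleftrightarrow> int r dvd d"
    unfolding of_int_eq_iff dvd_def by simp
  finally show ?thesis .
qed

text \<open>Lets the reduction in \<open>dotmod\<close> be dropped inside an exponent.\<close>

lemma root_of_1_powi_mod:
  assumes "r > 0"
  shows "root_of_1 r powi (d mod int r) = root_of_1 r powi d"
proof -
  have "root_of_1 r powi d = root_of_1 r powi (d mod int r + int r * (d div int r))"
    by simp
  also have "\<dots> = root_of_1 r powi (d mod int r)"
    unfolding root_of_1_powi_add using root_of_1_powi_eq_1_iff[OF assms] by simp
  finally show ?thesis by simp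
qed

text \<open>A geometric sum with ratio \<open>?z\<close>. If \<open>r\<close> does not divide
  \<open>d\<close>, then \<open>?z\<close> is not 1 while \<open>?z ^ r = 1\<close>, so the sum
  vanishes.\<close>

lemma sum_root_of_1_powi:
  assumes "r > 0"
  shows "(\<Sum>k<r. root_of_1 r powi (int k * d)) = (if int r dvd d then of_nat r else 0)"
proof -
  let ?z = "root_of_1 r powi d"
  have pow: "root_of_1 r powi (int k * d) = ?z ^ k" for k
    by (metis mult.commute power_int_mult power_int_of_nat)
  show ?thesis
  proof (cases "int r dvd d")
    case True
    then have "?z = 1"
      using root_of_1_powi_eq_1_iff[OF assms] by simp
    then show ?thesis
      using True by (simp add: pow)
  next
    case False
    have "?z ^ r = 1"
      using root_of_1_powi_eq_1_iff[OF assms, of "int r * d"] by (simp add: pow)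
    moreover have "?z \<noteq> 1"
      using False root_of_1_powi_eq_1_iff[OF assms] by simp
    ultimately show ?thesis
      using False by (simp add: pow sum_gp_strict)
  qed
qed

lemma sum_root_of_1_powi_int:
  assumes "r > 0"
  shows "(\<Sum>s\<in>{0..<int r}. root_of_1 r powi (s * d)) = (if int r dvd d then of_nat r else 0)"
proof -
  have "(\<Sum>s\<in>{0..<int r}. root_of_1 r powi (s * d)) = (\<Sum>k<r. root_of_1 r powi (int k * d))"
    by (rule sum.reindex_bij_witness[of _ int nat]) auto
  then show ?thesis
    using sum_root_of_1_powi[OF assms] by simp
qed

section \<open>Vectors of residues, their characters and Fourier expansion\<close>

lemma finite_Zvec [simp]: "finite I \<Longrightarrow> finite (Zvec r I)"
  by (simp add: Zvec_def finite_PiE)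

lemma card_Zvec: "finite I \<Longrightarrow> card (Zvec r I) = r ^ card I"
  by (simp add: Zvec_def card_PiE)

lemma Zvec_nonempty: "r > 0 \<Longrightarrow> Zvec r I \<noteq> {}"
  by (simp add: Zvec_def PiE_eq_empty_iff)

lemma root_of_1_powi_sum:
  "root_of_1 r powi (\<Sum>j\<in>I. f j) = (\<Prod>j\<in>I. root_of_1 r powi f j)"
  by (induction I rule: infinite_finite_induct) (auto simp: root_of_1_powi_add)

text \<open>Orthogonality of characters. The exponential turns the sum over \<open>j\<close> into a
  product, so the sum over vectors splits into one geometric sum per coordinate, and a single
  \<open>d j\<close> not divisible by \<open>r\<close> makes everything 0.\<close>

lemma sum_Zvec_root_of_1_powi:
  assumes "r > 0" "finite I"
  shows "(\<Sum>S\<in>Zvec r I. root_of_1 r powi (\<Sum>j\<in>I. S j * d j)) =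
    (if \<forall>j\<in>I. int r dvd d j then of_nat (r ^ card I) else 0)"
proof -
  have "(\<Sum>S\<in>Zvec r I. root_of_1 r powi (\<Sum>j\<in>I. S j * d j)) =
      (\<Prod>j\<in>I. \<Sum>s\<in>{0..<int r}. root_of_1 r powi (s * d j))"
    unfolding root_of_1_powi_sum Zvec_def using assms by (subst prod_sum_PiE) auto
  also have "\<dots> = (\<Prod>j\<in>I. if int r dvd d j then of_nat r else 0)"
    using sum_root_of_1_powi_int[OF assms(1)] by simp
  also have "\<dots> = (if \<forall>j\<in>I. int r dvd d j then of_nat (r ^ card I) else 0)"
    using assms(2) by auto
  finally show ?thesis .
qed

text \<open>Orthogonality only yields congruences; representatives in \<open>{0..<int r}\<close> and
  extensionality turn them into equality.\<close>

lemma Zvec_cong_imp_eq: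
  assumes "y \<in> Zvec r I" "z \<in> Zvec r I" "\<forall>j\<in>I. int r dvd y j - z j"
  shows "y = z"
proof (rule PiE_ext)
  show "y \<in> I \<rightarrow>\<^sub>E {0..<int r}" "z \<in> I \<rightarrow>\<^sub>E {0..<int r}"
    using assms by (auto simp: Zvec_def)
  fix j assume "j \<in> I"
  then have "y j \<in> {0..<int r}" "z j \<in> {0..<int r}" "int r dvd y j - z j"
    using assms by (auto simp: Zvec_def)
  then show "y j = z j"
    by (metis atLeastLessThan_iff mod_eq_dvd_iff mod_pos_pos_trivial)
qed

text \<open>The whole normalising factor sits here: the coefficients are averages, and the inversion
  formula carries no factor.\<close>

definition fourier_coeff ::
  "nat \<Rightarrow> nat set \<Rightarrow> ((nat \<Rightarrow> int) \<Rightarrow> complex) \<Rightarrow> (nat \<Rightarrow> int) \<Rightarrow> complex" where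
  "fourier_coeff r I h S =
     (\<Sum>z\<in>Zvec r I. h z * root_of_1 r powi (- (\<Sum>j\<in>I. S j * z j))) / of_nat (r ^ card I)"

text \<open>An average of \<open>r ^ card I\<close> numbers of norm at most 1.\<close>

lemma norm_fourier_coeff_le:
  assumes "r > 0" "finite I" "\<And>z. norm (h z) \<le> 1"
  shows "norm (fourier_coeff r I h S) \<le> 1"
proof -
  have "norm (\<Sum>z\<in>Zvec r I. h z * root_of_1 r powi (- (\<Sum>j\<in>I. S j * z j))) \<le>
      (\<Sum>z\<in>Zvec r I. 1)"
    by (rule sum_norm_le) (simp only: norm_mult norm_root_of_1_powi assms(3) mult_1_right)
  also have "\<dots> = real (r ^ card I)"
    using assms(2) by (simp add: card_Zvec)
  finally show ?thesis
    using assms(1) by (simp add: fourier_coeff_def norm_divide norm_power)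
qed

text \<open>After the sums are exchanged, the sum over \<open>S\<close> is the character sum at
  \<open>\<lambda>j. y j - z j\<close>, which is \<open>r ^ card I\<close> for \<open>z = y\<close>
  and 0 otherwise.\<close>

lemma fourier_inversion:
  assumes "r > 0" "finite I" "y \<in> Zvec r I"
  shows "(\<Sum>S\<in>Zvec r I. fourier_coeff r I h S * root_of_1 r powi dotmod r I S y) = h y"
proof -
  let ?R = "of_nat (r ^ card I) :: complex"
  have "(\<Sum>S\<in>Zvec r I. fourier_coeff r I h S * root_of_1 r powi dotmod r I S y) =
      (\<Sum>S\<in>Zvec r I. \<Sum>z\<in>Zvec r I.
         h z / ?R * root_of_1 r powi (\<Sum>j\<in>I. S j * (y j - z j)))"
    unfolding fourier_coeff_def dotmod_def root_of_1_powi_mod[OF assms(1)]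
      sum_divide_distrib sum_distrib_right
    by (intro sum.cong refl)
      (simp add: root_of_1_powi_add[symmetric] right_diff_distrib sum_subtractf)
  also have "\<dots> = (\<Sum>z\<in>Zvec r I. h z / ?R *
      (\<Sum>S\<in>Zvec r I. root_of_1 r powi (\<Sum>j\<in>I. S j * (y j - z j))))"
    by (subst sum.swap) (simp add: sum_distrib_left)
  also have "\<dots> = (\<Sum>z\<in>Zvec r I. if z = y then h z else 0)"
  proof (rule sum.cong[OF refl])
    fix z assume z: "z \<in> Zvec r I"
    have "(\<forall>j\<in>I. int r dvd y j - z j) \<longleftrightarrow> z = y"
      using Zvec_cong_imp_eq[OF assms(3) z] by auto
    then show "h z / ?R * (\<Sum>S\<in>Zvec r I. root_of_1 r powi (\<Sum>j\<in>I. S j * (y j - z j))) =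
        (if z = y then h z else 0)"
      using assms(1) by (simp add: sum_Zvec_root_of_1_powi[OF assms(1,2)])
  qed
  also have "\<dots> = h y"
    using assms by simp
  finally show ?thesis .
qed

section \<open>Prediction advantage and Fourier weight\<close>

lemma expectation_pmf_of_set:
  fixes f :: "'a \<Rightarrow> complex"
  assumes "finite X" "X \<noteq> {}"
  shows "measure_pmf.expectation (pmf_of_set X) f = (\<Sum>x\<in>X. f x) / of_nat (card X)"
  using assms
  by (subst integral_measure_pmf[of X])
    (auto simp: scaleR_conv_of_real divide_inverse sum_distrib_right mult.commute)

text \<open>The double sum of the theorem with its ingredients abstracted: \<open>x\<close> is
  uniform in \<open>X\<close>, \<open>Y x\<close> is what the decoder sees and \<open>b x\<close> is
  the symbol to be predicted.\<close>

definition fourier_weight ::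
  "nat \<Rightarrow> nat set \<Rightarrow> 'a set \<Rightarrow> ('a \<Rightarrow> nat \<Rightarrow> int) \<Rightarrow> ('a \<Rightarrow> int) \<Rightarrow> real" where
  "fourier_weight r Q X Y b = (\<Sum>k = 1..r - 1. \<Sum>S\<in>Zvec r Q.
     norm (measure_pmf.expectation (pmf_of_set X)
       (\<lambda>x. root_of_1 r powi (dotmod r Q S (Y x) - int k * b x))))"

text \<open>With \<open>D x\<close> the error of the prediction, averaging
  \<open>root_of_1 r powi (int k * D x)\<close> over \<open>k < r\<close> detects whether
  \<open>r\<close> divides \<open>D x\<close>. The term \<open>k = 0\<close> gives the guessing
  probability \<open>1 / real r\<close>; every other term is bounded by the matching summand of
  \<open>fourier_weight\<close>.\<close>

lemma prediction_prob_le: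
  fixes g :: "(nat \<Rightarrow> int) \<Rightarrow> int"
  assumes r: "r > 0" and Q: "finite Q" and X: "finite X" "X \<noteq> {}"
    and Y: "\<And>x. x \<in> X \<Longrightarrow> Y x \<in> Zvec r Q"
  shows "(\<Sum>x\<in>X. of_bool (g (Y x) = b x)) / real (card X) \<le>
    1 / real r + fourier_weight r Q X Y b / real r"
proof -
  define E where "E f = measure_pmf.expectation (pmf_of_set X) f" for f :: "'a \<Rightarrow> complex"
  define D where "D x = g (Y x) - b x" for x
  note E_eq = expectation_pmf_of_set[OF X, folded E_def]
  have term_le: "norm (\<Sum>x\<in>X. root_of_1 r powi (int k * D x)) / real (card X) \<le>
      (\<Sum>S\<in>Zvec r Q. norm (E (\<lambda>x. root_of_1 r powi (dotmod r Q S (Y x) - int k * b x))))" for k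
  proof -
    \<comment> \<open>This function has norm 1 everywhere, so its Fourier coefficients have norm at
      most 1 and disappear from the bound once it is expanded at \<open>Y x\<close>.\<close>
    let ?h = "\<lambda>y. root_of_1 r powi (int k * g y)"
    have "(\<Sum>x\<in>X. root_of_1 r powi (int k * D x)) =
        (\<Sum>x\<in>X. ?h (Y x) * root_of_1 r powi (- (int k * b x)))"
      by (simp add: D_def right_diff_distrib flip: root_of_1_powi_add)
    also have "\<dots> = (\<Sum>x\<in>X. \<Sum>S\<in>Zvec r Q. fourier_coeff r Q ?h S *
        root_of_1 r powi (dotmod r Q S (Y x) - int k * b x))"
    proof (rule sum.cong[OF refl])
      fix x assume "x \<in> X"
      then show "?h (Y x) * root_of_1 r powi (- (int k * b x)) =
          (\<Sum>S\<in>Zvec r Q. fourier_coeff r Q ?h S *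
            root_of_1 r powi (dotmod r Q S (Y x) - int k * b x))"
        by (subst fourier_inversion[OF r Q Y, of x ?h, symmetric])
          (simp_all add: sum_distrib_right mult.assoc flip: root_of_1_powi_add)
    qed
    also have "\<dots> = (\<Sum>S\<in>Zvec r Q. fourier_coeff r Q ?h S *
        (\<Sum>x\<in>X. root_of_1 r powi (dotmod r Q S (Y x) - int k * b x)))"
      by (subst sum.swap) (simp add: sum_distrib_left)
    also have "norm \<dots> \<le> (\<Sum>S\<in>Zvec r Q.
        norm (\<Sum>x\<in>X. root_of_1 r powi (dotmod r Q S (Y x) - int k * b x)))"
    proof (rule sum_norm_le)
      fix S
      show "norm (fourier_coeff r Q ?h S *
          (\<Sum>x\<in>X. root_of_1 r powi (dotmod r Q S (Y x) - int k * b x))) \<le>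
          norm (\<Sum>x\<in>X. root_of_1 r powi (dotmod r Q S (Y x) - int k * b x))"
        unfolding norm_mult using norm_fourier_coeff_le[OF r Q, of ?h S]
        by (intro mult_left_le_one_le) auto
    qed
    finally show ?thesis
      by (simp add: E_eq norm_divide divide_right_mono flip: sum_divide_distrib)
  qed
  have split: "{..<r} = insert 0 {1..r - 1}"
    using r by auto
  have "real r * (\<Sum>x\<in>X. of_bool (g (Y x) = b x)) \<le> (\<Sum>x\<in>X. real r * of_bool (int r dvd D x))"
    unfolding sum_distrib_left by (intro sum_mono) (auto simp: D_def)
  \<comment> \<open>The sum is real and nonnegative, hence equal to its norm; the triangle
    inequality can then be used after the expansion in roots of unity.\<close>
  also have "\<dots> = norm (\<Sum>x\<in>X. complex_of_real (real r * of_bool (int r dvd D x)))"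
    by (subst of_real_sum[symmetric], subst norm_of_real) (simp add: sum_nonneg)
  also have "(\<Sum>x\<in>X. complex_of_real (real r * of_bool (int r dvd D x))) =
      (\<Sum>x\<in>X. \<Sum>k<r. root_of_1 r powi (int k * D x))"
    unfolding sum_root_of_1_powi[OF r] by (intro sum.cong) auto
  also have "\<dots> = of_nat (card X) + (\<Sum>k = 1..r - 1. \<Sum>x\<in>X. root_of_1 r powi (int k * D x))"
    by (subst sum.swap) (simp add: split)
  also have "norm \<dots> \<le> real (card X) +
      (\<Sum>k = 1..r - 1. norm (\<Sum>x\<in>X. root_of_1 r powi (int k * D x)))"
    by (rule order_trans[OF norm_triangle_ineq]) (intro add_mono norm_sum, simp)
  finally have "real r * (\<Sum>x\<in>X. of_bool (g (Y x) = b x)) / real (card X) \<le>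
      (real (card X) + (\<Sum>k = 1..r - 1. norm (\<Sum>x\<in>X. root_of_1 r powi (int k * D x))))
        / real (card X)"
    by (rule divide_right_mono) simp
  also have "\<dots> = 1 +
      (\<Sum>k = 1..r - 1. norm (\<Sum>x\<in>X. root_of_1 r powi (int k * D x)) / real (card X))"
    using X by (simp add: add_divide_distrib sum_divide_distrib)
  also have "\<dots> \<le> 1 + fourier_weight r Q X Y b"
    unfolding fourier_weight_def E_def[symmetric] by (intro add_left_mono sum_mono term_le)
  finally show ?thesis
    using r by (simp add: field_simps)
qed

text \<open>Without queries the only \<open>S\<close> is the empty vector, and
  \<open>root_of_1 r powi (- (int k * x i))\<close> has mean 0 over a uniform symbol when
  \<open>0 < k < r\<close>. Hence the empty set is never good if \<epsilon> > 0.\<close>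

lemma fourier_weight_empty:
  assumes r: "r > 0" and "i < n"
  shows "fourier_weight r {} (Zvec r {..<n}) Y (\<lambda>x. x i) = 0"
proof -
  have "(\<Sum>x\<in>Zvec r {..<n}. root_of_1 r powi (- (int k * x i))) = 0"
    if k: "k \<in> {1..r - 1}" for k
  proof -
    \<comment> \<open>The exponent is a dot product with a vector supported at \<open>i\<close>, so
      the character sum over all messages applies.\<close>
    have "(\<Sum>j<n. x j * (if j = i then - int k else 0)) = - (int k * x i)" for x :: "nat \<Rightarrow> int"
      using \<open>i < n\<close> by (simp add: if_distrib cong: if_cong)
    moreover have "\<not> int r dvd int k"
      using k r by (auto dest: dvd_imp_le)
    ultimately show ?thesis
      using sum_Zvec_root_of_1_powi[OF r, of "{..<n}" "\<lambda>j. if j = i then - int k else 0"] \<open>i < n\<close>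
      by auto
  qed
  then show ?thesis
    using r by (simp add: fourier_weight_def dotmod_def expectation_pmf_of_set Zvec_nonempty)
qed

section \<open>Disjoint families and averaging over decoders\<close>

lemma obtain_maximal_disjoint_subfamily:
  assumes "finite F" "{} \<notin> F"
  obtains M where "M \<subseteq> F" "pairwise disjnt M" "\<And>Q. Q \<in> F \<Longrightarrow> Q \<inter> \<Union>M \<noteq> {}"
proof -
  let ?\<F> = "{M. M \<subseteq> F \<and> pairwise disjnt M}"
  have "finite ?\<F>" "{} \<in> ?\<F>"
    using assms(1) by auto
  then obtain M where M: "M \<in> ?\<F>" and max: "\<And>M'. M' \<in> ?\<F> \<Longrightarrow> M \<subseteq> M' \<Longrightarrow> M = M'"
    using finite_has_maximal[of ?\<F>] by (metis (no_types, lifting) empty_iff)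
  have "Q \<inter> \<Union>M \<noteq> {}" if "Q \<in> F" for Q
  proof
    assume disj: "Q \<inter> \<Union>M = {}"
    then have "insert Q M \<in> ?\<F>"
      using M that by (auto simp: pairwise_insert disjnt_def)
    \<comment> \<open>By maximality \<open>Q\<close> is already a member, so it lies inside a union
      from which it is disjoint; only the empty set does.\<close>
    then have "Q \<in> M"
      using max[of "insert Q M"] by blast
    then have "Q = {}"
      using disj by blast
    then show False
      using that assms(2) by simp
  qed
  with M that show thesis by blast
qed

text \<open>Success on every message gives success on average over a uniform message, and the
  averages over messages and decoders can be swapped. Query sets that are not good contribute at
  most half of the advantage \<epsilon>, so the good ones must have probability at least the other
  half.\<close>

lemma smooth_code_good_prob:
  fixes A :: "(nat set \<times> ((nat \<Rightarrow> int) \<Rightarrow> int)) pmf"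
  assumes r: "r > 0" and X: "finite X" "X \<noteq> {}"
    and W: "\<And>x. x \<in> X \<Longrightarrow> W x \<in> Zvec r {..<N}"
    and A: "\<And>Q g. (Q, g) \<in> set_pmf A \<Longrightarrow> Q \<subseteq> {..<N}"
    and succ: "\<And>x. x \<in> X \<Longrightarrow>
      pmf (map_pmf (\<lambda>(Q, g). g (restrict (W x) Q)) A) (b x) \<ge> 1 / real r + \<epsilon>"
    and "\<epsilon> \<ge> 0"
  shows "measure_pmf.prob A
    {(Q, g). fourier_weight r Q X (\<lambda>x. restrict (W x) Q) b \<ge> \<epsilon> * real r / 2} \<ge> \<epsilon> / 2"
proof -
  define f where "f Q = fourier_weight r Q X (\<lambda>x. restrict (W x) Q) b" for Q
  define G where "G = {(Q, g :: (nat \<Rightarrow> int) \<Rightarrow> int). f Q \<ge> \<epsilon> * real r / 2}"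
  define hit where "hit x = {(Q, g). g (restrict (W x) Q) = b x}" for x
  \<comment> \<open>The fraction of messages on which the deterministic decoder \<open>z\<close>
    answers correctly.\<close>
  define p where "p z = (\<Sum>x\<in>X. indicator (hit x) z) / real (card X)" for z
  have card: "card X > 0"
    using X by (simp add: card_gt_0_iff)
  have int_ind: "integrable (measure_pmf A) (indicator B :: _ \<Rightarrow> real)" for B
    by (intro measure_pmf.integrable_const_bound[where B = 1]) auto
  have succ': "measure_pmf.prob A (hit x) \<ge> 1 / real r + \<epsilon>" if "x \<in> X" for x
  proof -
    have "(\<lambda>(Q, g). g (restrict (W x) Q)) -` {b x} = hit x"
      by (auto simp: hit_def)
    then show ?thesis
      using succ[OF that] by (simp add: pmf_map)
  qed
  have "1 / real r + \<epsilon> = (\<Sum>x\<in>X. 1 / real r + \<epsilon>) / real (card X)"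
    using card by simp
  also have "\<dots> \<le> (\<Sum>x\<in>X. measure_pmf.prob A (hit x)) / real (card X)"
    by (intro divide_right_mono sum_mono succ') auto
  also have "\<dots> = measure_pmf.expectation A p"
    unfolding p_def using int_ind by simp
  \<comment> \<open>The bound is pointwise on the support. On \<open>G\<close> the indicator alone
    covers the trivial bound 1, the other summand being nonnegative; off \<open>G\<close> the
    prediction bound applies with \<open>f Q\<close> below the threshold.\<close>
  also have "\<dots> \<le> measure_pmf.expectation A (\<lambda>z. indicator G z + (1 / real r + \<epsilon> / 2))"
  proof (rule integral_mono_AE)
    show "integrable (measure_pmf A) p"
      unfolding p_def using int_ind by auto
    show "integrable (measure_pmf A) (\<lambda>z. indicator G z + (1 / real r + \<epsilon> / 2))"
      using int_ind by auto
    show "AE z in measure_pmf A. p z \<le> indicator G z + (1 / real r + \<epsilon> / 2)"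
      unfolding AE_measure_pmf_iff
    proof
      fix z assume z: "z \<in> set_pmf A"
      obtain Q g where zQ: "z = (Q, g)" by force
      have Q: "Q \<subseteq> {..<N}"
        using A z zQ by auto
      show "p z \<le> indicator G z + (1 / real r + \<epsilon> / 2)"
      proof (cases "z \<in> G")
        case True
        have "(\<Sum>x\<in>X. indicator (hit x) z) \<le> (\<Sum>x\<in>X. 1 :: real)"
          by (intro sum_mono) (auto simp: indicator_def)
        then have "p z \<le> 1"
          using card by (simp add: p_def)
        moreover have "0 \<le> 1 / real r + \<epsilon> / 2"
          using \<open>\<epsilon> \<ge> 0\<close> by simp
        ultimately show ?thesis
          using True by simp
      next
        case False
        have "restrict (W x) Q \<in> Zvec r Q" if "x \<in> X" for x
          using W[OF that] Q by (auto simp: Zvec_def)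
        then have "p z \<le> 1 / real r + f Q / real r"
          using prediction_prob_le[OF r finite_subset[OF Q finite_lessThan] X,
              of "\<lambda>x. restrict (W x) Q" g b]
          by (simp add: p_def zQ hit_def f_def indicator_def of_bool_def)
        moreover have "f Q / real r \<le> \<epsilon> / 2"
          using False r by (simp add: G_def zQ field_simps)
        ultimately have "p z \<le> 1 / real r + \<epsilon> / 2"
          by linarith
        then show ?thesis
          using False by simp
      qed
    qed
  qed
  also have "\<dots> = measure_pmf.prob A G + (1 / real r + \<epsilon> / 2)"
    using int_ind by simp
  finally show ?thesis
    by (simp add: G_def f_def)
qed

section \<open>Counting a maximal disjoint family of good sets\<close>

theorem theorem5p5:
  fixes r n N q :: nat and c \<epsilon> :: real and C :: "(nat \<Rightarrow> int) \<Rightarrow> (nat \<Rightarrow> int)"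
  assumes "r \<ge> 2"
    and "smooth_code r n N q c \<epsilon> C"
  shows "\<forall>i<n. \<exists>M :: nat set set.
    real (card M) \<ge> \<epsilon> * real N / (2 * c * real q) \<and>
    pairwise disjnt M \<and>
    (\<forall>Q\<in>M. Q \<subseteq> {..<N} \<and> card Q \<le> q \<and>
      (\<Sum>k = 1..r - 1. \<Sum>S\<in>Zvec r Q.
         norm (measure_pmf.expectation (pmf_of_set (Zvec r {..<n}))
           (\<lambda>x. root_of_1 r powi (dotmod r Q S (restrict (C x) Q) - int k * x i))))
      \<ge> \<epsilon> * real r / 2)"
proof (intro allI impI)
  fix i assume i: "i < n"
  define X where "X = Zvec r {..<n}"
  define f where "f Q = fourier_weight r Q X (\<lambda>x. restrict (C x) Q) (\<lambda>x. x i)" for Q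
  have r: "r > 0"
    using assms(1) by simp
  obtain A :: decoder where
    C: "C \<in> X \<rightarrow> Zvec r {..<N}" and
    A: "\<And>Q g. (Q, g) \<in> set_pmf (A i) \<Longrightarrow> Q \<subseteq> {..<N} \<and> card Q \<le> q" and
    succ: "\<And>x. x \<in> X \<Longrightarrow> pmf (decode A (C x) i) (x i) \<ge> 1 / real r + \<epsilon>" and
    smooth: "\<And>j. j < N \<Longrightarrow> measure_pmf.prob (A i) {(Q, g). j \<in> Q} \<le> c / real N"
    using assms(2) i unfolding smooth_code_def X_def by fast
  show "\<exists>M. real (card M) \<ge> \<epsilon> * real N / (2 * c * real q) \<and> pairwise disjnt M \<and>
    (\<forall>Q\<in>M. Q \<subseteq> {..<N} \<and> card Q \<le> q \<and>
      (\<Sum>k = 1..r - 1. \<Sum>S\<in>Zvec r Q.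
         norm (measure_pmf.expectation (pmf_of_set (Zvec r {..<n}))
           (\<lambda>x. root_of_1 r powi (dotmod r Q S (restrict (C x) Q) - int k * x i))))
      \<ge> \<epsilon> * real r / 2)"
    unfolding X_def[symmetric] fourier_weight_def[symmetric] f_def[symmetric]
  proof (cases "\<epsilon> > 0 \<and> N > 0 \<and> c > 0 \<and> q > 0")
    case False
    \<comment> \<open>In the degenerate cases the required cardinality is at most 0, with division
      by 0 giving 0, so the empty family suffices. A negative \<open>c\<close> is excluded for
      \<open>N > 0\<close> because it bounds a probability.\<close>
    have "c \<ge> 0" if "N > 0"
      using order_trans[OF measure_nonneg smooth[OF that]] that by (simp add: zero_le_divide_iff)
    with False have "\<epsilon> * real N / (2 * c * real q) \<le> 0"
      by (cases "N = 0"; cases "c = 0"; cases "q = 0")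
        (auto simp: not_less divide_nonpos_nonneg mult_nonpos_nonneg)
    then show "\<exists>M. real (card M) \<ge> \<epsilon> * real N / (2 * c * real q) \<and> pairwise disjnt M \<and>
        (\<forall>Q\<in>M. Q \<subseteq> {..<N} \<and> card Q \<le> q \<and> f Q \<ge> \<epsilon> * real r / 2)"
      by (intro exI[of _ "{}"]) simp
  next
    case True
    then have pos: "\<epsilon> > 0" "N > 0" "c > 0" "q > 0" by auto
    \<comment> \<open>All good sets of admissible size, whether or not the decoder ever queries
      them.\<close>
    define F where "F = {Q. Q \<subseteq> {..<N} \<and> card Q \<le> q \<and> f Q \<ge> \<epsilon> * real r / 2}"
    have "finite F"
      by (rule finite_subset[of _ "Pow {..<N}"]) (auto simp: F_def)
    \<comment> \<open>The empty set has weight 0, below the positive threshold.\<close>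
    moreover have "{} \<notin> F"
      using fourier_weight_empty[OF r i] pos r
      by (auto simp: F_def f_def X_def mult_le_0_iff)
    ultimately obtain M where M: "M \<subseteq> F" "pairwise disjnt M"
      and meets: "\<And>Q. Q \<in> F \<Longrightarrow> Q \<inter> \<Union>M \<noteq> {}"
      using obtain_maximal_disjoint_subfamily by metis
    have "\<Union>M \<subseteq> {..<N}"
      using M by (auto simp: F_def)
    have "card (\<Union>M) \<le> (\<Sum>Q\<in>M. card Q)"
      using card_Union_le_sum_card by blast
    also have "\<dots> \<le> card M * q"
      using M sum_bounded_above[of M card q] by (auto simp: F_def)
    finally have card_Union: "real (card (\<Union>M)) \<le> real (card M) * real q"
      by (simp only: of_nat_le_iff flip: of_nat_mult)
    have "\<epsilon> / 2 \<le> measure_pmf.prob (A i) {(Q, g). f Q \<ge> \<epsilon> * real r / 2}"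
      unfolding f_def
    proof (rule smooth_code_good_prob[OF r, where N = N])
      show "finite X" "X \<noteq> {}"
        using r by (auto simp: X_def Zvec_nonempty)
      show "C x \<in> Zvec r {..<N}" if "x \<in> X" for x
        using C that by blast
      show "Q \<subseteq> {..<N}" if "(Q, g) \<in> set_pmf (A i)" for Q g
        using A[OF that] by blast
      show "pmf (map_pmf (\<lambda>(Q, g). g (restrict (C x) Q)) (A i)) (x i) \<ge> 1 / real r + \<epsilon>"
        if "x \<in> X" for x
        using succ[OF that] by (simp only: decode_def)
      show "\<epsilon> \<ge> 0"
        using pos by simp
    qed
    \<comment> \<open>A good queried set belongs to \<open>F\<close>, so by maximality it contains a
      coordinate of \<open>\<Union>M\<close>. The inclusion is needed only on the support, where the
      query sets are known to be admissible.\<close>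
    also have "\<dots> \<le> measure_pmf.prob (A i) (\<Union>j\<in>\<Union>M. {(Q, g). j \<in> Q})"
    proof (rule measure_pmf.finite_measure_mono_AE)
      show "AE z in measure_pmf (A i). z \<in> {(Q, g). f Q \<ge> \<epsilon> * real r / 2} \<longrightarrow>
          z \<in> (\<Union>j\<in>\<Union>M. {(Q, g). j \<in> Q})"
        unfolding AE_measure_pmf_iff
      proof (intro ballI impI)
        fix z assume z: "z \<in> set_pmf (A i)" "z \<in> {(Q, g). f Q \<ge> \<epsilon> * real r / 2}"
        then have "fst z \<in> F"
          using A[of "fst z" "snd z"] by (simp add: F_def split_beta)
        then show "z \<in> (\<Union>j\<in>\<Union>M. {(Q, g). j \<in> Q})"
          using meets[of "fst z"] by (auto simp: split_beta)
      qed
    qed simp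
    \<comment> \<open>Union bound over the coordinates covered by \<open>M\<close>; smoothness then
      bounds each term by \<open>c / real N\<close>.\<close>
    also have "\<dots> \<le> (\<Sum>j\<in>\<Union>M. measure_pmf.prob (A i) {(Q, g). j \<in> Q})"
      using finite_subset[OF \<open>\<Union>M \<subseteq> {..<N}\<close> finite_lessThan]
      by (rule measure_pmf.finite_measure_subadditive_finite) simp
    also have "\<dots> \<le> real (card (\<Union>M)) * (c / real N)"
      using \<open>\<Union>M \<subseteq> {..<N}\<close> smooth by (intro sum_bounded_above) auto
    also have "\<dots> \<le> real (card M) * real q * (c / real N)"
      using card_Union pos by (intro mult_right_mono) auto
    finally have "\<epsilon> * real N / (2 * c * real q) \<le> real (card M)"
      using pos by (simp add: field_simps)
    then show "\<exists>M. real (card M) \<ge> \<epsilon> * real N / (2 * c * real q) \<and> pairwise disjnt M \<and>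
        (\<forall>Q\<in>M. Q \<subseteq> {..<N} \<and> card Q \<le> q \<and> f Q \<ge> \<epsilon> * real r / 2)"
      using M by (intro exI[of _ M]) (auto simp: F_def)
  qed
qed

end
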